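(* There is a numerical (absolute) constant $C_{\rm I}>0$ such that the following holds. Let $A,B\subset\mathbb Z^2$ be finite sets containing Cartesian rectangles $J_A=J_{A,1}\times J_{A,2}\subset A$ and $J_B=J_{B,1}\times J_{B,2}\subset B$ with contiguous integer intervals as factors; set $L_A=\min_i|J_{A,i}|$, $L_B=\min_i|J_{B,i}|$ and assume $L_A,L_B\ge2$. Let $\Delta$ satisfy $$\Delta\ge\frac{C_{\rm I}}{\min\{\Delta q_1,\Delta q_2\}}\max\{L_A^{-1},L_B^{-1}\}.$$ Suppose additionally that either $A$ or $B$ contains a translate of $\{0,\ldots,s\}^2$. Then there is a constant $c_{\rm M}>0$, depending only on $A,B,\mathcal F,s,\Delta,\Delta q_1$ and $\Delta q_2$, such that for every $\Delta$-separated set $\mathcal T=\{\boldsymbol t_1,\dots,\boldsymbol t_s\}\subset\mathcal F$ of cardinality $s$, $$\mathcal R(\boldsymbol t)\ge c_{\rm M}\min\{\Delta/4,\ d_{\rm per}(\boldsymbol t,\mathcal T)\}\qquad\text{for all }\boldsymbol t\in\mathcal F.$$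
   Context: Fix spacings $\Delta q_1,\Delta q_2>0$ and $s\ge1$. $\mathcal F\subset\mathbb R^2$ is a compact axis-parallel rectangle (field of view) whose side lengths are smaller than the periods $2\pi/\Delta q_1$ and $2\pi/\Delta q_2$, respectively. The periodic distance is $$d_{\rm per}(\boldsymbol t,\boldsymbol t')=\Big[\min_{m\in\mathbb Z}|t_1-t_1'-2\pi m/\Delta q_1|^2+\min_{m\in\mathbb Z}|t_2-t_2'-2\pi m/\Delta q_2|^2\Big]^{1/2},$$ and $d_{\rm per}(\boldsymbol t,\mathcal T)=\min_j d_{\rm per}(\boldsymbol t,\boldsymbol t_j)$. A set is $\Delta$-separated if all pairwise periodic distances of distinct points are at least $\Delta$ (for $s=1$, $\Delta>0$ is just a prescribed scale). For $C\in\{A,B\}$ and $\boldsymbol t\in\mathbb R^2$ let $\boldsymbol v_C(\boldsymbol t)\in\mathbb C^{|C|}$, $[\boldsymbol v_C(\boldsymbol t)]_\alpha=e^{-\mathrm i(\alpha_1\Delta q_1t_1+\alpha_2\Delta q_2t_2)}$, and let $V_C=[\boldsymbol v_C(\boldsymbol t_1)\ \cdots\ \boldsymbol v_C(\boldsymbol t_s)]$. The exact two-sided MUSIC residual of $\mathcal T$ is $$\mathcal R(\boldsymbol t)=\Big[\frac{\|(I-P_A)\boldsymbol v_A(\boldsymbol t)\|_2^2}{|A|}+\frac{\|(I-P_B)\overline{\boldsymbol v_B(\boldsymbol t)}\|_2^2}{|B|}\Big]^{1/2},$$ where $P_A$ and $P_B$ are the orthogonal projectors onto $\operatorname{range}(V_A)$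 and $\operatorname{range}(\overline{V_B})$ (bar = entrywise complex conjugate). *)

theory Defs
  imports "HOL-Analysis.Analysis"
begin

text \<open>
  Complex vectors indexed by a finite set \<open>A\<close> are represented by functions that vanish outside \<open>A\<close>,
  so that equality of vectors is equality of functions.  A family \<open>W\<close> of such vectors indexed by
  the elements of a finite set \<open>T\<close> plays the role of the matrix with columns \<open>W t\<close>.
\<close>

definition cinner_on :: "'i set \<Rightarrow> ('i \<Rightarrow> complex) \<Rightarrow> ('i \<Rightarrow> complex) \<Rightarrow> complex" where
  "cinner_on A f g = (\<Sum>\<alpha>\<in>A. f \<alpha> * cnj (g \<alpha>))"

definition cnorm_on :: "'i set \<Rightarrow> ('i \<Rightarrow> complex) \<Rightarrow> real" where
  "cnorm_on A f = L2_set (\<lambda>\<alpha>. cmod (f \<alpha>)) A"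

definition column_range :: "'t set \<Rightarrow> ('t \<Rightarrow> 'i \<Rightarrow> complex) \<Rightarrow> ('i \<Rightarrow> complex) set" where
  "column_range T W = {f. \<exists>c. f = (\<lambda>\<alpha>. \<Sum>t\<in>T. c t * W t \<alpha>)}"

definition orth_proj_on ::
    "'i set \<Rightarrow> ('i \<Rightarrow> complex) set \<Rightarrow> ('i \<Rightarrow> complex) \<Rightarrow> ('i \<Rightarrow> complex)" where
  "orth_proj_on A S v =
     (THE p. p \<in> S \<and> (\<forall>w\<in>S. cinner_on A (\<lambda>\<alpha>. v \<alpha> - p \<alpha>) w = 0))"

lemma column_range_lincomb:
  assumes "f \<in> column_range T W" "g \<in> column_range T W"
  shows "(\<lambda>\<alpha>. a * f \<alpha> + b * g \<alpha>) \<in> column_range T W"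
proof -
  obtain c d where "f = (\<lambda>\<alpha>. \<Sum>t\<in>T. c t * W t \<alpha>)" "g = (\<lambda>\<alpha>. \<Sum>t\<in>T. d t * W t \<alpha>)"
    using assms unfolding column_range_def by blast
  then have "(\<lambda>\<alpha>. a * f \<alpha> + b * g \<alpha>) = (\<lambda>\<alpha>. \<Sum>t\<in>T. (a * c t + b * d t) * W t \<alpha>)"
    by (simp add: fun_eq_iff sum.distrib sum_distrib_left algebra_simps)
  then show ?thesis unfolding column_range_def by (auto intro: exI[of _ "\<lambda>t. a * c t + b * d t"])
qed

lemma column_range_insert:
  assumes "finite T" "x \<notin> T"
  shows "f \<in> column_range (insert x T) W \<longleftrightarrow>
    (\<exists>a. \<exists>g\<in>column_range T W. f = (\<lambda>\<alpha>. a * W x \<alpha> + g \<alpha>))"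
proof
  assume "f \<in> column_range (insert x T) W"
  then obtain c where "f = (\<lambda>\<alpha>. \<Sum>t\<in>insert x T. c t * W t \<alpha>)"
    unfolding column_range_def by blast
  then show "\<exists>a. \<exists>g\<in>column_range T W. f = (\<lambda>\<alpha>. a * W x \<alpha> + g \<alpha>)"
    using assms unfolding column_range_def
    by (intro exI[of _ "c x"] bexI[of _ "\<lambda>\<alpha>. \<Sum>t\<in>T. c t * W t \<alpha>"]) auto
next
  assume "\<exists>a. \<exists>g\<in>column_range T W. f = (\<lambda>\<alpha>. a * W x \<alpha> + g \<alpha>)"
  then obtain a c where f: "f = (\<lambda>\<alpha>. a * W x \<alpha> + (\<Sum>t\<in>T. c t * W t \<alpha>))"
    unfolding column_range_def by blast
  have "(\<Sum>t\<in>T. (c(x := a)) t * W t \<alpha>) = (\<Sum>t\<in>T. c t * W t \<alpha>)" for \<alpha>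
    using assms by (intro sum.cong) auto
  then have "f = (\<lambda>\<alpha>. \<Sum>t\<in>insert x T. (c(x := a)) t * W t \<alpha>)"
    using assms f by simp
  then show "f \<in> column_range (insert x T) W" unfolding column_range_def by blast
qed

lemma cinner_on_lincomb_left:
  "cinner_on A (\<lambda>\<alpha>. a * f \<alpha> + b * g \<alpha>) h = a * cinner_on A f h + b * cinner_on A g h"
  unfolding cinner_on_def by (simp add: sum.distrib sum_distrib_left algebra_simps)

lemma cinner_on_lincomb_right:
  "cinner_on A h (\<lambda>\<alpha>. a * f \<alpha> + b * g \<alpha>) = cnj a * cinner_on A h f + cnj b * cinner_on A h g"
  unfolding cinner_on_def by (simp add: sum.distrib sum_distrib_left algebra_simps)

lemma cinner_on_self_eq_0:
  assumes "finite A" "cinner_on A f f = 0" "\<alpha> \<in> A"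
  shows "f \<alpha> = 0"
proof -
  have "cinner_on A f f = of_real (\<Sum>\<alpha>\<in>A. (cmod (f \<alpha>))\<^sup>2)"
    unfolding cinner_on_def of_real_sum
    by (intro sum.cong refl) (simp only: complex_norm_square)
  then have "(\<Sum>\<alpha>\<in>A. (cmod (f \<alpha>))\<^sup>2) = 0" using assms(2) of_real_eq_0_iff by metis
  then show ?thesis using assms(1,3) by (simp add: sum_nonneg_eq_0_iff)
qed

lemma column_range_orth_decomp:
  assumes "finite A" "finite T"
  shows "\<exists>p\<in>column_range T W. \<forall>w\<in>column_range T W. cinner_on A (\<lambda>\<alpha>. v \<alpha> - p \<alpha>) w = 0"
  using assms(2)
proof (induction T arbitrary: v rule: finite_induct)
  case empty
  show ?case by (auto simp: column_range_def cinner_on_def)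
next
  case (insert x T)
  obtain p where p: "p \<in> column_range T W"
    "\<And>w. w \<in> column_range T W \<Longrightarrow> cinner_on A (\<lambda>\<alpha>. v \<alpha> - p \<alpha>) w = 0"
    using insert.IH by metis
  obtain q where q: "q \<in> column_range T W"
    "\<And>w. w \<in> column_range T W \<Longrightarrow> cinner_on A (\<lambda>\<alpha>. W x \<alpha> - q \<alpha>) w = 0"
    using insert.IH by metis
  define u where "u = (\<lambda>\<alpha>. W x \<alpha> - q \<alpha>)"
  define r where "r = (\<lambda>\<alpha>. v \<alpha> - p \<alpha>)"
  define k where "k = cinner_on A r u / cinner_on A u u"
  have uT: "cinner_on A u w = 0" and rT: "cinner_on A r w = 0" if "w \<in> column_range T W" for w
    using p q that unfolding u_def r_def by auto
  have ru: "cinner_on A r u = k * cinner_on A u u"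
  proof (cases "cinner_on A u u = 0")
    case True
    then have "\<And>\<alpha>. \<alpha> \<in> A \<Longrightarrow> u \<alpha> = 0" using cinner_on_self_eq_0[OF assms(1)] by blast
    then have "cinner_on A r u = 0" unfolding cinner_on_def by simp
    then show ?thesis using True by simp
  qed (simp add: k_def)
  let ?p = "\<lambda>\<alpha>. p \<alpha> + k * u \<alpha>"
  have "?p = (\<lambda>\<alpha>. k * W x \<alpha> + (1 * p \<alpha> + (- k) * q \<alpha>))"
    by (simp add: fun_eq_iff u_def algebra_simps)
  moreover have "(\<lambda>\<alpha>. 1 * p \<alpha> + (- k) * q \<alpha>) \<in> column_range T W"
    using p q by (intro column_range_lincomb) auto
  ultimately have 1: "?p \<in> column_range (insert x T) W"
    unfolding column_range_insert[OF insert.hyps] by (intro exI[of _ k] bexI)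
  have 2: "cinner_on A (\<lambda>\<alpha>. v \<alpha> - ?p \<alpha>) w = 0" if w: "w \<in> column_range (insert x T) W" for w
  proof -
    obtain a g where g: "g \<in> column_range T W" "w = (\<lambda>\<alpha>. a * W x \<alpha> + g \<alpha>)"
      using w[unfolded column_range_insert[OF insert.hyps]] by (elim exE bexE) (rule that)
    define h where "h = (\<lambda>\<alpha>. a * q \<alpha> + 1 * g \<alpha>)"
    have h: "h \<in> column_range T W" unfolding h_def using q g by (intro column_range_lincomb)
    have w': "w = (\<lambda>\<alpha>. a * u \<alpha> + 1 * h \<alpha>)"
      by (simp add: g fun_eq_iff h_def u_def algebra_simps)
    have e: "(\<lambda>\<alpha>. v \<alpha> - ?p \<alpha>) = (\<lambda>\<alpha>. 1 * r \<alpha> + (- k) * u \<alpha>)"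
      by (simp add: fun_eq_iff r_def algebra_simps)
    show ?thesis
      unfolding e w' cinner_on_lincomb_left cinner_on_lincomb_right
      using uT[OF h] rT[OF h] ru by simp
  qed
  show ?case by (rule bexI[OF _ 1], rule ballI, rule 2)
qed

lemma orth_proj_on_ex1:
  assumes "finite A" "finite T" "\<And>t \<alpha>. t \<in> T \<Longrightarrow> \<alpha> \<notin> A \<Longrightarrow> W t \<alpha> = 0"
  shows "\<exists>!p. p \<in> column_range T W \<and>
    (\<forall>w\<in>column_range T W. cinner_on A (\<lambda>\<alpha>. v \<alpha> - p \<alpha>) w = 0)"
proof (rule ex_ex1I)
  show "\<exists>p. p \<in> column_range T W \<and>
    (\<forall>w\<in>column_range T W. cinner_on A (\<lambda>\<alpha>. v \<alpha> - p \<alpha>) w = 0)"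
    using column_range_orth_decomp[OF assms(1,2)] by blast
next
  fix p p'
  assume p: "p \<in> column_range T W \<and>
      (\<forall>w\<in>column_range T W. cinner_on A (\<lambda>\<alpha>. v \<alpha> - p \<alpha>) w = 0)"
    and p': "p' \<in> column_range T W \<and>
      (\<forall>w\<in>column_range T W. cinner_on A (\<lambda>\<alpha>. v \<alpha> - p' \<alpha>) w = 0)"
  define d where "d = (\<lambda>\<alpha>. 1 * p \<alpha> + (- 1) * p' \<alpha>)"
  have d: "d \<in> column_range T W" unfolding d_def using p p' by (intro column_range_lincomb) auto
  have "d = (\<lambda>\<alpha>. 1 * (v \<alpha> - p' \<alpha>) + (- 1) * (v \<alpha> - p \<alpha>))"
    by (simp add: d_def fun_eq_iff)
  then have "cinner_on A d d =
      1 * cinner_on A (\<lambda>\<alpha>. v \<alpha> - p' \<alpha>) d + (- 1) * cinner_on A (\<lambda>\<alpha>. v \<alpha> - p \<alpha>) d"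
    by (metis cinner_on_lincomb_left)
  then have "cinner_on A d d = 0" using p p' d by simp
  then have in0: "d \<alpha> = 0" if "\<alpha> \<in> A" for \<alpha> using cinner_on_self_eq_0[OF assms(1)] that by blast
  have out0: "d \<alpha> = 0" if "\<alpha> \<notin> A" for \<alpha>
    using d assms(3)[OF _ that] unfolding column_range_def by auto
  have "d \<alpha> = 0" for \<alpha> using in0 out0 by blast
  then show "p = p'" by (simp add: d_def fun_eq_iff)
qed

definition steering :: "real \<Rightarrow> real \<Rightarrow> (int \<times> int) set \<Rightarrow> real \<times> real \<Rightarrow> (int \<times> int \<Rightarrow> complex)" where
  "steering dq1 dq2 C t = (\<lambda>\<alpha>. if \<alpha> \<in> C
     then exp (- \<i> * complex_of_real (of_int (fst \<alpha>) * dq1 * fst t + of_int (snd \<alpha>) * dq2 * snd t))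
     else 0)"

definition steering_cnj :: "real \<Rightarrow> real \<Rightarrow> (int \<times> int) set \<Rightarrow> real \<times> real \<Rightarrow> (int \<times> int \<Rightarrow> complex)" where
  "steering_cnj dq1 dq2 C t = (\<lambda>\<alpha>. cnj (steering dq1 dq2 C t \<alpha>))"

definition music_residual ::
    "real \<Rightarrow> real \<Rightarrow> (int \<times> int) set \<Rightarrow> (int \<times> int) set \<Rightarrow> (real \<times> real) set \<Rightarrow> real \<times> real \<Rightarrow> real" where
  "music_residual dq1 dq2 A B T t =
    (let vA = steering dq1 dq2 A t;
         vB = steering_cnj dq1 dq2 B t;
         PA = orth_proj_on A (column_range T (steering dq1 dq2 A));
         PB = orth_proj_on B (column_range T (steering_cnj dq1 dq2 B))
     in sqrt ((cnorm_on A (\<lambda>\<alpha>. vA \<alpha> - PA vA \<alpha>))\<^sup>2 / real (card A)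
            + (cnorm_on B (\<lambda>\<alpha>. vB \<alpha> - PB vB \<alpha>))\<^sup>2 / real (card B)))"

text \<open>The infima over the integers below are attained, so they are the minima.\<close>

definition dper :: "real \<Rightarrow> real \<Rightarrow> real \<times> real \<Rightarrow> real \<times> real \<Rightarrow> real" where
  "dper dq1 dq2 t t' =
     sqrt ((INF m::int. \<bar>fst t - fst t' - 2 * pi * of_int m / dq1\<bar>\<^sup>2)
         + (INF m::int. \<bar>snd t - snd t' - 2 * pi * of_int m / dq2\<bar>\<^sup>2))"

definition dper_set :: "real \<Rightarrow> real \<Rightarrow> real \<times> real \<Rightarrow> (real \<times> real) set \<Rightarrow> real" where
  "dper_set dq1 dq2 t T = Min (dper dq1 dq2 t ` T)"

definition per_separated :: "real \<Rightarrow> real \<Rightarrow> real \<Rightarrow> (real \<times> real) set \<Rightarrow> bool" where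
  "per_separated dq1 dq2 \<Delta> T \<longleftrightarrow> (\<forall>t\<in>T. \<forall>t'\<in>T. t \<noteq> t' \<longrightarrow> \<Delta> \<le> dper dq1 dq2 t t')"

definition field_of_view :: "real \<Rightarrow> real \<Rightarrow> (real \<times> real) set \<Rightarrow> bool" where
  "field_of_view dq1 dq2 F \<longleftrightarrow>
     (\<exists>a1 b1 a2 b2. a1 \<le> b1 \<and> a2 \<le> b2 \<and> F = {a1..b1} \<times> {a2..b2}
        \<and> b1 - a1 < 2 * pi / dq1 \<and> b2 - a2 < 2 * pi / dq2)"

definition int_interval :: "int set \<Rightarrow> bool" where
  "int_interval J \<longleftrightarrow> (\<exists>a b. J = {a..b})"

definition contains_translated_grid :: "nat \<Rightarrow> (int \<times> int) set \<Rightarrow> bool" where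
  "contains_translated_grid s A \<longleftrightarrow>
     (\<exists>p1 p2. (\<lambda>(k1, k2). (p1 + k1, p2 + k2)) ` ({0..int s} \<times> {0..int s}) \<subseteq> A)"

end

theory Submission
  imports Defs
begin

text \<open>
  Write \<open>z(t) = (exp (- \<i> q1 t1), exp (- \<i> q2 t2))\<close>, so that the steering vector of \<open>t\<close> lists the
  monomials in \<open>z(t)\<close> with exponents in the aperture.  Up to normalization, the residual of
  one side is the distance from the steering vector of \<open>t\<close> to the span of the steering vectors of the sources.  It is large as
  soon as some bounded linear functional annihilates all source vectors but is large at the vector
  of \<open>t\<close> (lemma \<open>functional_le_residual\<close>).  A functional on steering vectors is a
  polynomial in \<open>z\<close> with exponents in the aperture, so a polynomial of small norm is sought that
  vanishes at the sources and not at \<open>t\<close>.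

  Such a polynomial is a product of \<open>s\<close> linear factors (lemma \<open>exists_annihilating_polynomial\<close>).
  For each source \<open>x\<close> take the factor \<open>z1 - z1(x)\<close> or \<open>z2 - z2(x)\<close>, whichever is larger in modulus
  at \<open>t\<close>; this larger modulus is the chordal distance \<open>chord\<close> between \<open>t\<close> and \<open>x\<close>.  The product has
  degree at most \<open>s\<close> in each variable, so its exponents fit into a translate of \<open>{0..s}\<^sup>2\<close>; its
  coefficients have absolute sum at most \<open>2 ^ s\<close>; and its modulus at \<open>t\<close> is the product of the
  chordal distances from \<open>t\<close> to the sources.

  Finally, the chordal distance dominates a constant times the periodic distance
  (\<open>dper_le_chord\<close>).  By the triangle inequality all sources but the nearest one keep a
  distance from \<open>t\<close> proportional to \<open>\<Delta>\<close>, and the nearest one contributes a factor proportional to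
  \<open>dper_set\<close> (\<open>prod_chord_ge\<close>).  This gives an explicit constant.  Complex conjugation amounts to
  negating both spacings, so one argument serves both sides of the residual.
\<close>

section \<open>Residuals are bounded below by annihilating functionals\<close>

text \<open>
  The functional \<open>g\<close> does not see the projection, which is a combination of the columns \<open>W t\<close>; only
  the residual vector is left, and the Cauchy--Schwarz inequality applies to it.
\<close>

lemma functional_le_residual:
  assumes A: "finite A" and T: "finite T"
    and W: "\<And>t \<alpha>. t \<in> T \<Longrightarrow> \<alpha> \<notin> A \<Longrightarrow> W t \<alpha> = 0"
    and g: "\<And>t. t \<in> T \<Longrightarrow> (\<Sum>\<alpha>\<in>A. W t \<alpha> * g \<alpha>) = 0"
  shows "cmod (\<Sum>\<alpha>\<in>A. v \<alpha> * g \<alpha>)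
    \<le> cnorm_on A (\<lambda>\<alpha>. v \<alpha> - orth_proj_on A (column_range T W) v \<alpha>) * cnorm_on A g"
proof -
  define p where "p = orth_proj_on A (column_range T W) v"
  have "p \<in> column_range T W"
    using theI'[OF orth_proj_on_ex1[where v = v and W = W, OF A T W]]
    unfolding p_def orth_proj_on_def by blast
  then obtain c where c: "p = (\<lambda>\<alpha>. \<Sum>t\<in>T. c t * W t \<alpha>)"
    unfolding column_range_def by blast
  have "(\<Sum>\<alpha>\<in>A. p \<alpha> * g \<alpha>) = (\<Sum>t\<in>T. c t * (\<Sum>\<alpha>\<in>A. W t \<alpha> * g \<alpha>))"
    unfolding c sum_distrib_right sum_distrib_left
    by (subst sum.swap) (simp add: mult.assoc)
  then have "(\<Sum>\<alpha>\<in>A. v \<alpha> * g \<alpha>) = (\<Sum>\<alpha>\<in>A. (v \<alpha> - p \<alpha>) * g \<alpha>)"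
    using g by (simp add: left_diff_distrib sum_subtractf)
  also have "cmod \<dots> \<le> (\<Sum>\<alpha>\<in>A. cmod (v \<alpha> - p \<alpha>) * cmod (g \<alpha>))"
    by (rule norm_sum[THEN order_trans]) (simp add: norm_mult)
  also have "\<dots> \<le> cnorm_on A (\<lambda>\<alpha>. v \<alpha> - p \<alpha>) * cnorm_on A g"
    using L2_set_mult_ineq[of "\<lambda>\<alpha>. cmod (v \<alpha> - p \<alpha>)" "\<lambda>\<alpha>. cmod (g \<alpha>)" A]
    unfolding cnorm_on_def by simp
  finally show ?thesis unfolding p_def .
qed

section \<open>The chordal distance on the torus\<close>

text \<open>
  The maximum metric on the pair of unit circles, pulled back to the plane.  Unlike the periodic
  distance it needs no minimum over periods, and its two entries are the moduli of the linear
  factors that occur below.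
\<close>

definition chord :: "real \<Rightarrow> real \<Rightarrow> real \<times> real \<Rightarrow> real \<times> real \<Rightarrow> real" where
  "chord q1 q2 t t' =
     max (cmod (cis (- q1 * fst t) - cis (- q1 * fst t')))
         (cmod (cis (- q2 * snd t) - cis (- q2 * snd t')))"

lemma chord_commute: "chord q1 q2 t t' = chord q1 q2 t' t"
  unfolding chord_def by (simp add: norm_minus_commute)

lemma chord_nonneg: "0 \<le> chord q1 q2 t t'"
  unfolding chord_def by (simp add: max.coboundedI1)

lemma chord_triangle: "chord q1 q2 t t'' \<le> chord q1 q2 t t' + chord q1 q2 t' t''"
  unfolding chord_def
  using norm_triangle_ineq[of "cis (- q1 * fst t) - cis (- q1 * fst t')"
      "cis (- q1 * fst t') - cis (- q1 * fst t'')"]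
    norm_triangle_ineq[of "cis (- q2 * snd t) - cis (- q2 * snd t')"
      "cis (- q2 * snd t') - cis (- q2 * snd t'')"]
  by (simp add: max_def split: if_splits)

text \<open>This transfers results on \<open>steering\<close> to \<open>steering_cnj\<close>.\<close>

lemma chord_uminus: "chord (- q1) (- q2) t t' = chord q1 q2 t t'"
proof -
  have "cmod (cis (- a) - cis (- b)) = cmod (cis a - cis b)" for a b
    by (metis cis_cnj complex_cnj_diff complex_mod_cnj)
  then show ?thesis unfolding chord_def by (metis minus_mult_left minus_minus)
qed

text \<open>The sine is concave on \<open>[0, \<pi>]\<close>, hence above its secant over \<open>[0, \<pi> / 2]\<close>.\<close>

lemma Jordan_inequality:
  fixes x :: real
  assumes "0 \<le> x" "x \<le> pi / 2"
  shows "2 / pi * x \<le> sin x"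
proof -
  have cv: "concave_on {0..pi} sin"
    unfolding concave_on_def
  proof (rule f''_ge0_imp_convex)
    show "((\<lambda>x. - sin x) has_real_derivative - cos x) (at x)" for x :: real
      by (auto intro!: derivative_eq_intros)
    show "((\<lambda>x. - cos x) has_real_derivative sin x) (at x)" for x :: real
      by (auto intro!: derivative_eq_intros)
    show "0 \<le> sin x" if "x \<in> {0..pi}" for x :: real
      using that by (simp add: sin_ge_zero)
  qed simp
  show ?thesis
    using concave_onD[OF cv, of "2 / pi * x" 0 "pi / 2"] assms
    by (simp add: field_simps)
qed

text \<open>
  Reducing the phase \<open>q (x - y)\<close> modulo \<open>2 \<pi>\<close> to some \<open>z\<close> with \<open>\<bar>z\<bar> \<le> \<pi>\<close>, the chord is
  \<open>2 \<bar>sin (z / 2)\<bar> \<ge> 2 \<bar>z\<bar> / \<pi>\<close> by Jordan's inequality, and \<open>(\<bar>z\<bar> / q)\<^sup>2\<close> is one of the numbers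
  over which the infimum ranges.
\<close>

lemma periodic_distance_le_chord:
  fixes q x y :: real
  assumes q: "q > 0"
  shows "(INF m::int. \<bar>x - y - 2 * pi * of_int m / q\<bar>\<^sup>2)
    \<le> (pi / (2 * q) * cmod (cis (- q * x) - cis (- q * y)))\<^sup>2"
proof -
  define m where "m = round (q * (x - y) / (2 * pi))"
  define z where "z = q * (x - y) - 2 * pi * of_int m"
  define w where "w = q * (x - y) / (2 * pi)"
  have "\<bar>of_int m - w\<bar> \<le> 1 / 2"
    unfolding m_def w_def by (rule of_int_round_abs_le)
  moreover have "z = 2 * pi * (w - of_int m)"
    unfolding z_def w_def by (simp add: field_simps)
  ultimately have z: "\<bar>z\<bar> \<le> pi"
    by (simp add: abs_mult abs_minus_commute)
  have "cis (- q * x) - cis (- q * y) = cis (- q * x) * (1 - cis (q * (x - y)))"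
    by (simp add: cis_mult algebra_simps)
  also have "cis (q * (x - y)) = cis z"
    unfolding z_def by (simp flip: cis_divide)
  finally have "cmod (cis (- q * x) - cis (- q * y)) = cmod (1 - cis z)"
    by (simp add: norm_mult)
  also have "\<dots> = 2 * \<bar>sin (z / 2)\<bar>"
    using dist_exp_i_1[of z] by (simp add: cis_conv_exp norm_minus_commute)
  also have "\<bar>sin (z / 2)\<bar> = sin (\<bar>z\<bar> / 2)"
    using z sin_ge_zero[of "z / 2"] sin_ge_zero[of "- z / 2"] by (cases "z \<ge> 0") auto
  finally have "2 / pi * \<bar>z\<bar> \<le> cmod (cis (- q * x) - cis (- q * y))"
    using Jordan_inequality[of "\<bar>z\<bar> / 2"] z by simp
  then have "\<bar>z\<bar> / q \<le> pi / (2 * q) * cmod (cis (- q * x) - cis (- q * y))"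
    using q by (simp add: field_simps)
  moreover have "\<bar>x - y - 2 * pi * of_int m / q\<bar> = \<bar>z\<bar> / q"
  proof -
    have "x - y - 2 * pi * of_int m / q = z / q" using q by (simp add: z_def field_simps)
    then show ?thesis using q by simp
  qed
  ultimately have "\<bar>x - y - 2 * pi * of_int m / q\<bar>\<^sup>2
      \<le> (pi / (2 * q) * cmod (cis (- q * x) - cis (- q * y)))\<^sup>2"
    by (intro power_mono) auto
  moreover have "(INF m::int. \<bar>x - y - 2 * pi * of_int m / q\<bar>\<^sup>2)
      \<le> \<bar>x - y - 2 * pi * of_int m / q\<bar>\<^sup>2"
    by (rule cINF_lower) (auto intro: bdd_belowI[of _ 0])
  ultimately show ?thesis by linarith
qed

lemma dper_le_chord:
  assumes q: "q1 > 0" "q2 > 0"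
  shows "dper q1 q2 t t' \<le> (pi / (2 * q1) + pi / (2 * q2)) * chord q1 q2 t t'"
proof -
  define a where "a = pi / (2 * q1) * cmod (cis (- q1 * fst t) - cis (- q1 * fst t'))"
  define b where "b = pi / (2 * q2) * cmod (cis (- q2 * snd t) - cis (- q2 * snd t'))"
  have a: "0 \<le> a" "a \<le> pi / (2 * q1) * chord q1 q2 t t'"
  proof -
    have k: "0 \<le> pi / (2 * q1)" using q by simp
    then show "0 \<le> a" unfolding a_def by (rule mult_nonneg_nonneg) simp
    show "a \<le> pi / (2 * q1) * chord q1 q2 t t'"
      unfolding a_def chord_def by (rule mult_left_mono[OF _ k]) simp
  qed
  have b: "0 \<le> b" "b \<le> pi / (2 * q2) * chord q1 q2 t t'"
  proof -
    have k: "0 \<le> pi / (2 * q2)" using q by simp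
    then show "0 \<le> b" unfolding b_def by (rule mult_nonneg_nonneg) simp
    show "b \<le> pi / (2 * q2) * chord q1 q2 t t'"
      unfolding b_def chord_def by (rule mult_left_mono[OF _ k]) simp
  qed
  have "dper q1 q2 t t' \<le> sqrt (a\<^sup>2 + b\<^sup>2)"
    unfolding dper_def a_def b_def
    using periodic_distance_le_chord[OF q(1), of "fst t" "fst t'"]
      periodic_distance_le_chord[OF q(2), of "snd t" "snd t'"]
    by (intro real_sqrt_le_mono add_mono)
  also have "\<dots> \<le> a + b" using a(1) b(1) by (rule sqrt_sum_squares_le_sum)
  finally show ?thesis using a b by (simp add: distrib_right)
qed

section \<open>Products of linear factors\<close>

definition wave :: "real \<Rightarrow> real \<Rightarrow> int \<times> int \<Rightarrow> real \<times> real \<Rightarrow> complex" where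
  "wave q1 q2 \<alpha> t = cis (- (of_int (fst \<alpha>) * q1 * fst t + of_int (snd \<alpha>) * q2 * snd t))"

definition grid :: "nat \<Rightarrow> (int \<times> int) set" where
  "grid n = {0..int n} \<times> {0..int n}"

lemma wave_add: "wave q1 q2 (\<alpha> + \<beta>) t = wave q1 q2 \<alpha> t * wave q1 q2 \<beta> t"
  unfolding wave_def by (simp add: cis_mult algebra_simps)

lemma norm_wave: "cmod (wave q1 q2 \<alpha> t) = 1"
  unfolding wave_def by simp

lemma finite_grid: "finite (grid n)"
  unfolding grid_def by simp

lemma chord_attained:
  obtains e where "e \<in> {(1, 0), (0, 1)}"
    "cmod (wave q1 q2 e t - wave q1 q2 e t') = chord q1 q2 t t'"
proof (cases "cmod (cis (- q1 * fst t) - cis (- q1 * fst t'))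
      \<le> cmod (cis (- q2 * snd t) - cis (- q2 * snd t'))")
  case True
  then show ?thesis using that[of "(0, 1)"] unfolding chord_def wave_def by simp
next
  case False
  then show ?thesis using that[of "(1, 0)"] unfolding chord_def wave_def by simp
qed

text \<open>
  Here \<open>g \<alpha>\<close> is the coefficient of the monomial \<open>wave q1 q2 \<alpha>\<close>.  Adding a source \<open>x\<close> multiplies
  the polynomial by \<open>wave q1 q2 e - wave q1 q2 e x\<close>, where \<open>e\<close> is the coordinate direction in which
  \<open>t\<close> and \<open>x\<close> have the larger chord.  This raises each degree by at most one,
  at most doubles the sum of the moduli of the coefficients, and multiplies the value at \<open>t\<close> by a factor of modulus
  \<open>chord q1 q2 t x\<close>.
\<close>

lemma exists_annihilating_polynomial:
  assumes "finite T"
  shows "\<exists>g. (\<forall>\<alpha>. \<alpha> \<notin> grid (card T) \<longrightarrow> g \<alpha> = 0)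
    \<and> (\<Sum>\<alpha>\<in>grid (card T). cmod (g \<alpha>)) \<le> 2 ^ card T
    \<and> (\<forall>t'\<in>T. (\<Sum>\<alpha>\<in>grid (card T). wave q1 q2 \<alpha> t' * g \<alpha>) = 0)
    \<and> cmod (\<Sum>\<alpha>\<in>grid (card T). wave q1 q2 \<alpha> t * g \<alpha>) = (\<Prod>t'\<in>T. chord q1 q2 t t')"
  using assms
proof (induction T rule: finite_induct)
  case empty
  have "grid 0 = {(0, 0)}" unfolding grid_def by auto
  then show ?case
    by (intro exI[of _ "\<lambda>\<alpha>. if \<alpha> = (0, 0) then 1 else 0"]) (simp add: norm_wave)
next
  case (insert x T)
  define n where "n = card T"
  obtain g where g0: "\<And>\<alpha>. \<alpha> \<notin> grid n \<Longrightarrow> g \<alpha> = 0"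
    and g1: "(\<Sum>\<alpha>\<in>grid n. cmod (g \<alpha>)) \<le> 2 ^ n"
    and g2: "\<And>t'. t' \<in> T \<Longrightarrow> (\<Sum>\<alpha>\<in>grid n. wave q1 q2 \<alpha> t' * g \<alpha>) = 0"
    and g3: "cmod (\<Sum>\<alpha>\<in>grid n. wave q1 q2 \<alpha> t * g \<alpha>) = (\<Prod>t'\<in>T. chord q1 q2 t t')"
    using insert.IH unfolding n_def by blast
  have card: "card (insert x T) = Suc n" using insert.hyps by (simp add: n_def)
  obtain e where e: "e \<in> {(1, 0), (0, 1)}"
    and ch: "cmod (wave q1 q2 e t - wave q1 q2 e x) = chord q1 q2 t x"
    by (rule chord_attained)
  have sub: "grid n \<subseteq> grid (Suc n)" unfolding grid_def by auto
  have sub': "(\<lambda>\<beta>. \<beta> + e) ` grid n \<subseteq> grid (Suc n)" using e unfolding grid_def by auto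
  have out: "g (\<alpha> - e) = 0" if "\<alpha> \<notin> (\<lambda>\<beta>. \<beta> + e) ` grid n" for \<alpha>
    using that by (intro g0) (metis diff_add_cancel image_eqI)
  have plain: "(\<Sum>\<alpha>\<in>grid (Suc n). F \<alpha> (g \<alpha>)) = (\<Sum>\<alpha>\<in>grid n. F \<alpha> (g \<alpha>))"
    if "\<And>\<alpha>. F \<alpha> 0 = 0" for F :: "int \<times> int \<Rightarrow> complex \<Rightarrow> 'c::comm_monoid_add"
    using sub that g0 by (intro sum.mono_neutral_right) (auto simp: finite_grid)
  have shift: "(\<Sum>\<alpha>\<in>grid (Suc n). F \<alpha> (g (\<alpha> - e))) = (\<Sum>\<beta>\<in>grid n. F (\<beta> + e) (g \<beta>))"
    if "\<And>\<alpha>. F \<alpha> 0 = 0" for F :: "int \<times> int \<Rightarrow> complex \<Rightarrow> 'c::comm_monoid_add"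
  proof -
    have "(\<Sum>\<alpha>\<in>grid (Suc n). F \<alpha> (g (\<alpha> - e)))
        = (\<Sum>\<alpha>\<in>(\<lambda>\<beta>. \<beta> + e) ` grid n. F \<alpha> (g (\<alpha> - e)))"
      using sub' that out by (intro sum.mono_neutral_right) (auto simp: finite_grid)
    also have "\<dots> = (\<Sum>\<beta>\<in>grid n. F (\<beta> + e) (g \<beta>))"
      by (subst sum.reindex) (auto simp: inj_on_def)
    finally show ?thesis .
  qed
  \<comment> \<open>The coefficients of the product with the linear factor.\<close>
  define h where "h = (\<lambda>\<alpha>. g (\<alpha> - e) - wave q1 q2 e x * g \<alpha>)"
  have h0: "h \<alpha> = 0" if "\<alpha> \<notin> grid (Suc n)" for \<alpha>
    using that sub sub' g0 out unfolding h_def by (metis diff_self mult_zero_right subsetD)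
  have "(\<Sum>\<alpha>\<in>grid (Suc n). cmod (h \<alpha>))
      \<le> (\<Sum>\<alpha>\<in>grid (Suc n). cmod (g (\<alpha> - e)) + cmod (g \<alpha>))"
    unfolding h_def
    by (intro sum_mono norm_triangle_ineq4[THEN order_trans]) (simp add: norm_mult norm_wave)
  also have "\<dots> = 2 * (\<Sum>\<alpha>\<in>grid n. cmod (g \<alpha>))"
    using plain[of "\<lambda>_. cmod"] shift[of "\<lambda>_. cmod"] by (simp add: sum.distrib)
  finally have h1: "(\<Sum>\<alpha>\<in>grid (Suc n). cmod (h \<alpha>)) \<le> 2 ^ Suc n" using g1 by simp
  have factor: "(\<Sum>\<alpha>\<in>grid (Suc n). wave q1 q2 \<alpha> r * h \<alpha>)
      = (wave q1 q2 e r - wave q1 q2 e x) * (\<Sum>\<alpha>\<in>grid n. wave q1 q2 \<alpha> r * g \<alpha>)" for r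
  proof -
    have "(\<Sum>\<alpha>\<in>grid (Suc n). wave q1 q2 \<alpha> r * h \<alpha>)
        = (\<Sum>\<alpha>\<in>grid (Suc n). wave q1 q2 \<alpha> r * g (\<alpha> - e))
          - wave q1 q2 e x * (\<Sum>\<alpha>\<in>grid (Suc n). wave q1 q2 \<alpha> r * g \<alpha>)"
      unfolding h_def by (simp add: sum_subtractf sum_distrib_left algebra_simps)
    also have "\<dots> = (\<Sum>\<alpha>\<in>grid n. wave q1 q2 (\<alpha> + e) r * g \<alpha>)
          - wave q1 q2 e x * (\<Sum>\<alpha>\<in>grid n. wave q1 q2 \<alpha> r * g \<alpha>)"
      using plain[of "\<lambda>\<alpha> c. wave q1 q2 \<alpha> r * c"] shift[of "\<lambda>\<alpha> c. wave q1 q2 \<alpha> r * c"] by simp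
    also have "(\<Sum>\<alpha>\<in>grid n. wave q1 q2 (\<alpha> + e) r * g \<alpha>)
        = wave q1 q2 e r * (\<Sum>\<alpha>\<in>grid n. wave q1 q2 \<alpha> r * g \<alpha>)"
      by (simp add: wave_add sum_distrib_left mult_ac)
    finally show ?thesis by (simp add: left_diff_distrib)
  qed
  have h3: "cmod (\<Sum>\<alpha>\<in>grid (Suc n). wave q1 q2 \<alpha> t * h \<alpha>) = (\<Prod>t'\<in>insert x T. chord q1 q2 t t')"
    using insert.hyps unfolding factor by (simp add: norm_mult ch g3)
  show ?case
    unfolding card using h0 h1 h3 g2 by (intro exI[of _ h]) (auto simp: factor)
qed

lemma steering_eq_wave: "steering q1 q2 A t \<alpha> = (if \<alpha> \<in> A then wave q1 q2 \<alpha> t else 0)"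
  unfolding steering_def wave_def by (simp add: cis_conv_exp algebra_simps)

lemma steering_cnj_eq: "steering_cnj q1 q2 A = steering (- q1) (- q2) A"
  by (auto simp: fun_eq_iff steering_cnj_def steering_eq_wave wave_def cis_cnj)

lemma card_pos_if_contains_grid:
  assumes "finite A" "contains_translated_grid n A"
  shows "card A > 0"
  using assms unfolding contains_translated_grid_def
  by (force simp: card_gt_0_iff)

text \<open>
  Translating the exponents by \<open>p\<close>, so that they lie in \<open>A\<close>, multiplies the polynomial by the
  monomial \<open>wave q1 q2 p\<close>; this has modulus one and changes neither its zeros nor its modulus at \<open>t\<close>.
\<close>

lemma prod_chord_le_residual:
  assumes A: "finite A" and T: "finite T" and gr: "contains_translated_grid (card T) A"
  shows "(\<Prod>t'\<in>T. chord q1 q2 t t')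
    \<le> cnorm_on A (\<lambda>\<alpha>. steering q1 q2 A t \<alpha>
          - orth_proj_on A (column_range T (steering q1 q2 A)) (steering q1 q2 A t) \<alpha>)
      * 2 ^ card T"
proof -
  let ?n = "card T"
  obtain p where "(\<lambda>\<beta>. p + \<beta>) ` grid ?n \<subseteq> A"
    using gr unfolding contains_translated_grid_def grid_def
    by (force simp: image_subset_iff)
  then have p: "(\<lambda>\<beta>. \<beta> + p) ` grid ?n \<subseteq> A" by (simp add: add.commute)
  obtain g where g0: "\<And>\<alpha>. \<alpha> \<notin> grid ?n \<Longrightarrow> g \<alpha> = 0"
    and g1: "(\<Sum>\<alpha>\<in>grid ?n. cmod (g \<alpha>)) \<le> 2 ^ ?n"
    and g2: "\<And>t'. t' \<in> T \<Longrightarrow> (\<Sum>\<alpha>\<in>grid ?n. wave q1 q2 \<alpha> t' * g \<alpha>) = 0"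
    and g3: "cmod (\<Sum>\<alpha>\<in>grid ?n. wave q1 q2 \<alpha> t * g \<alpha>) = (\<Prod>t'\<in>T. chord q1 q2 t t')"
    using exists_annihilating_polynomial[OF T] by blast
  have out: "g (\<alpha> - p) = 0" if "\<alpha> \<notin> (\<lambda>\<beta>. \<beta> + p) ` grid ?n" for \<alpha>
    using that by (intro g0) (metis diff_add_cancel image_eqI)
  have shift: "(\<Sum>\<alpha>\<in>A. F \<alpha> (g (\<alpha> - p))) = (\<Sum>\<beta>\<in>grid ?n. F (\<beta> + p) (g \<beta>))"
    if "\<And>\<alpha>. F \<alpha> 0 = 0" for F :: "int \<times> int \<Rightarrow> complex \<Rightarrow> 'c::comm_monoid_add"
  proof -
    have "(\<Sum>\<alpha>\<in>A. F \<alpha> (g (\<alpha> - p)))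
        = (\<Sum>\<alpha>\<in>(\<lambda>\<beta>. \<beta> + p) ` grid ?n. F \<alpha> (g (\<alpha> - p)))"
      using p that out A by (intro sum.mono_neutral_right) auto
    also have "\<dots> = (\<Sum>\<beta>\<in>grid ?n. F (\<beta> + p) (g \<beta>))"
      by (subst sum.reindex) (auto simp: inj_on_def)
    finally show ?thesis .
  qed
  define h where "h = (\<lambda>\<alpha>. g (\<alpha> - p))"
  have st: "(\<Sum>\<alpha>\<in>A. steering q1 q2 A r \<alpha> * h \<alpha>)
      = wave q1 q2 p r * (\<Sum>\<alpha>\<in>grid ?n. wave q1 q2 \<alpha> r * g \<alpha>)" for r
    using shift[of "\<lambda>\<alpha> c. wave q1 q2 \<alpha> r * c"]
    by (simp add: h_def steering_eq_wave wave_add sum_distrib_left algebra_simps)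
  have "cnorm_on A h \<le> (\<Sum>\<alpha>\<in>A. cmod (h \<alpha>))"
    unfolding cnorm_on_def by (rule L2_set_le_sum) simp
  also have "\<dots> \<le> 2 ^ ?n"
    using shift[of "\<lambda>_. cmod"] g1 by (simp add: h_def)
  finally have h1: "cnorm_on A h \<le> 2 ^ ?n" .
  have "(\<Prod>t'\<in>T. chord q1 q2 t t') = cmod (\<Sum>\<alpha>\<in>A. steering q1 q2 A t \<alpha> * h \<alpha>)"
    unfolding st by (simp add: norm_mult norm_wave g3)
  also have "\<dots> \<le> cnorm_on A (\<lambda>\<alpha>. steering q1 q2 A t \<alpha>
          - orth_proj_on A (column_range T (steering q1 q2 A)) (steering q1 q2 A t) \<alpha>)
      * cnorm_on A h"
    using A T by (rule functional_le_residual) (simp_all only: st g2, simp_all add: steering_eq_wave)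
  also have "\<dots> \<le> cnorm_on A (\<lambda>\<alpha>. steering q1 q2 A t \<alpha>
          - orth_proj_on A (column_range T (steering q1 q2 A)) (steering q1 q2 A t) \<alpha>)
      * 2 ^ ?n"
    using h1 by (intro mult_left_mono) (simp_all add: cnorm_on_def L2_set_nonneg)
  finally show ?thesis .
qed

section \<open>Separated sources\<close>

text \<open>
  Let \<open>x\<close> be the source nearest to \<open>t\<close> in chordal distance.  Any other source \<open>y\<close> satisfies
  \<open>\<Delta> / K \<le> chord q1 q2 x y \<le> 2 * chord q1 q2 t y\<close>, which bounds the \<open>card T - 1\<close>
  factors that belong to sources other than \<open>x\<close>.
\<close>

lemma prod_chord_ge:
  assumes q: "q1 > 0" "q2 > 0" and T: "finite T" "T \<noteq> {}"
    and sep: "per_separated q1 q2 \<Delta> T" and \<Delta>: "\<Delta> \<ge> 0"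
    and K: "K = pi / (2 * q1) + pi / (2 * q2)"
  shows "(\<Delta> / (2 * K)) ^ (card T - 1) * (dper_set q1 q2 t T / K) \<le> (\<Prod>t'\<in>T. chord q1 q2 t t')"
proof -
  have K0: "K > 0" unfolding K using q by (simp add: add_pos_pos)
  have dK: "dper q1 q2 r r' / K \<le> chord q1 q2 r r'" for r r'
    using dper_le_chord[OF q, of r r'] K0 unfolding K[symmetric] by (simp add: field_simps)
  obtain x where x: "x \<in> T" and near: "\<And>y. y \<in> T \<Longrightarrow> chord q1 q2 t x \<le> chord q1 q2 t y"
    using ex_is_arg_min_if_finite[OF T, of "chord q1 q2 t"]
    unfolding is_arg_min_linorder by blast
  have far: "\<Delta> / (2 * K) \<le> chord q1 q2 t y" if y: "y \<in> T - {x}" for y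
  proof -
    have "\<Delta> \<le> dper q1 q2 x y" using sep x y unfolding per_separated_def by auto
    then have "\<Delta> / K \<le> dper q1 q2 x y / K" using K0 by (simp add: divide_right_mono)
    also have "\<dots> \<le> chord q1 q2 x y" by (rule dK)
    also have "\<dots> \<le> chord q1 q2 t x + chord q1 q2 t y"
      using chord_triangle[of q1 q2 x y t] by (simp add: chord_commute)
    also have "\<dots> \<le> 2 * chord q1 q2 t y" using near y by auto
    finally show ?thesis using K0 by (simp add: field_simps)
  qed
  have "dper_set q1 q2 t T / K \<le> dper q1 q2 t x / K"
    unfolding dper_set_def using T x K0 by (intro divide_right_mono) auto
  also have "\<dots> \<le> chord q1 q2 t x" by (rule dK)
  finally have 1: "dper_set q1 q2 t T / K \<le> chord q1 q2 t x" .
  have "(\<Delta> / (2 * K)) ^ (card T - 1) = (\<Prod>y\<in>T - {x}. \<Delta> / (2 * K))"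
    using x T by simp
  also have "\<dots> \<le> (\<Prod>y\<in>T - {x}. chord q1 q2 t y)"
    using far \<Delta> K0 by (intro prod_mono) auto
  finally have "(\<Delta> / (2 * K)) ^ (card T - 1) * (dper_set q1 q2 t T / K)
      \<le> (\<Prod>y\<in>T - {x}. chord q1 q2 t y) * chord q1 q2 t x"
    using \<Delta> K0 1
    by (smt (verit) chord_nonneg divide_nonneg_pos mult_left_mono mult_right_mono zero_le_power)
  also have "\<dots> = (\<Prod>t'\<in>T. chord q1 q2 t t')"
    using x T by (simp add: prod.remove mult.commute)
  finally show ?thesis .
qed

text \<open>
  Only the side whose aperture contains the grid is kept.  Replacing its cardinality by
  \<open>card A + card B\<close> makes the bound the same in both cases.
\<close>

lemma music_residual_ge:
  assumes "finite A" "finite B" "finite T"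
    and grid: "contains_translated_grid (card T) A \<or> contains_translated_grid (card T) B"
  shows "(\<Prod>t'\<in>T. chord q1 q2 t t') / (2 ^ card T * sqrt (real (card A + card B)))
    \<le> music_residual q1 q2 A B T t"
proof -
  define \<rho> where "\<rho> = (\<lambda>C q1 q2. cnorm_on C (\<lambda>\<alpha>. steering q1 q2 C t \<alpha>
      - orth_proj_on C (column_range T (steering q1 q2 C)) (steering q1 q2 C t) \<alpha>))"
  have R: "music_residual q1 q2 A B T t
      = sqrt ((\<rho> A q1 q2)\<^sup>2 / real (card A) + (\<rho> B (- q1) (- q2))\<^sup>2 / real (card B))"
    unfolding music_residual_def Let_def steering_cnj_eq \<rho>_def ..
  have main: "(\<Prod>t'\<in>T. chord q1 q2 t t') / (2 ^ card T * sqrt (real (card A + card B)))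
      \<le> sqrt (r\<^sup>2 / real (card C))"
    if "(\<Prod>t'\<in>T. chord q1 q2 t t') \<le> r * 2 ^ card T" "card C > 0" "card C \<le> card A + card B"
    for r and C :: "(int \<times> int) set"
  proof -
    have r: "0 \<le> r"
      using that(1) prod_nonneg[of T "chord q1 q2 t"] chord_nonneg
      by (smt (verit) mult_neg_pos zero_less_power)
    have "(\<Prod>t'\<in>T. chord q1 q2 t t') / (2 ^ card T * sqrt (real (card A + card B)))
        \<le> r / sqrt (real (card A + card B))"
      using that by (simp add: field_simps)
    also have "\<dots> \<le> r / sqrt (real (card C))"
      using that r by (intro divide_left_mono) (auto intro!: mult_pos_pos simp del: of_nat_add)
    also have "\<dots> = sqrt (r\<^sup>2 / real (card C))"
      using r by (simp add: real_sqrt_divide)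
    finally show ?thesis .
  qed
  from grid show ?thesis
  proof
    assume A: "contains_translated_grid (card T) A"
    have "(\<Prod>t'\<in>T. chord q1 q2 t t') \<le> \<rho> A q1 q2 * 2 ^ card T"
      unfolding \<rho>_def using assms(1,3) A by (rule prod_chord_le_residual)
    from main[OF this card_pos_if_contains_grid[OF assms(1) A]] show ?thesis
      unfolding R by (rule order_trans) (simp_all add: real_sqrt_le_mono)
  next
    assume B: "contains_translated_grid (card T) B"
    have "(\<Prod>t'\<in>T. chord q1 q2 t t') \<le> \<rho> B (- q1) (- q2) * 2 ^ card T"
      unfolding \<rho>_def using prod_chord_le_residual[OF assms(2,3) B, of "- q1" "- q2"]
      by (simp only: chord_uminus)
    from main[OF this card_pos_if_contains_grid[OF assms(2) B]] show ?thesis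
      unfolding R by (rule order_trans) (simp_all add: real_sqrt_le_mono)
  qed
qed

theorem proposition4p6:
  "\<exists>C_I>0. \<forall>(dq1::real) (dq2::real) (s::nat) (F::(real \<times> real) set)
      (A::(int \<times> int) set) (B::(int \<times> int) set)
      (JA1::int set) (JA2::int set) (JB1::int set) (JB2::int set)
      (LA::nat) (LB::nat) (\<Delta>::real).
     dq1 > 0 \<and> dq2 > 0 \<and> s \<ge> 1 \<and> field_of_view dq1 dq2 F
     \<and> finite A \<and> finite B
     \<and> int_interval JA1 \<and> int_interval JA2 \<and> int_interval JB1 \<and> int_interval JB2
     \<and> JA1 \<times> JA2 \<subseteq> A \<and> JB1 \<times> JB2 \<subseteq> B
     \<and> LA = min (card JA1) (card JA2) \<and> LB = min (card JB1) (card JB2)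
     \<and> LA \<ge> 2 \<and> LB \<ge> 2
     \<and> \<Delta> \<ge> C_I / min dq1 dq2 * max (1 / real LA) (1 / real LB)
     \<and> (contains_translated_grid s A \<or> contains_translated_grid s B)
     \<longrightarrow> (\<exists>c_M>0. \<forall>T. T \<subseteq> F \<and> card T = s \<and> per_separated dq1 dq2 \<Delta> T
            \<longrightarrow> (\<forall>t\<in>F. music_residual dq1 dq2 A B T t
                        \<ge> c_M * min (\<Delta> / 4) (dper_set dq1 dq2 t T)))"
  \<comment> \<open>With \<open>C_I = 1\<close> the hypothesis on \<open>\<Delta>\<close> yields \<open>\<Delta> > 0\<close>, which makes the constant \<open>c\<close> below
      positive.\<close>
proof (rule exI[of _ "1::real"], intro conjI allI impI zero_less_one, elim conjE)
  fix dq1 dq2 :: real and s LA LB :: nat and F :: "(real \<times> real) set"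
    and A B :: "(int \<times> int) set" and JA1 JA2 JB1 JB2 :: "int set" and \<Delta> :: real
  assume q: "dq1 > 0" "dq2 > 0" and s: "s \<ge> 1" and fin: "finite A" "finite B"
    and L: "LA \<ge> 2" "LB \<ge> 2"
    and sep_scale: "\<Delta> \<ge> 1 / min dq1 dq2 * max (1 / real LA) (1 / real LB)"
    and gr: "contains_translated_grid s A \<or> contains_translated_grid s B"
  have "0 < 1 / min dq1 dq2 * max (1 / real LA) (1 / real LB)"
    using q L by (intro mult_pos_pos) (auto simp: less_max_iff_disj)
  then have \<Delta>: "\<Delta> > 0" using sep_scale by linarith
  define K where "K = pi / (2 * dq1) + pi / (2 * dq2)"
  have K: "K > 0" unfolding K_def using q by (simp add: add_pos_pos)
  define N where "N = 2 ^ s * sqrt (real (card A + card B))"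
  have "card A + card B > 0"
    using gr fin card_pos_if_contains_grid[of _ s] by (metis add_gr_0)
  then have N: "N > 0" unfolding N_def by (simp del: of_nat_add)
  define c where "c = (\<Delta> / (2 * K)) ^ (s - 1) / (K * N)"
  have c: "c > 0" unfolding c_def using \<Delta> K N by simp
  show "\<exists>c_M>0. \<forall>T. T \<subseteq> F \<and> card T = s \<and> per_separated dq1 dq2 \<Delta> T
      \<longrightarrow> (\<forall>t\<in>F. music_residual dq1 dq2 A B T t
            \<ge> c_M * min (\<Delta> / 4) (dper_set dq1 dq2 t T))"
  proof (intro exI[of _ c] conjI c allI impI ballI, elim conjE)
    fix T :: "(real \<times> real) set" and t :: "real \<times> real"
    assume T: "card T = s" and sep: "per_separated dq1 dq2 \<Delta> T"
    have fT: "finite T" "T \<noteq> {}" using T s by (auto intro: card_ge_0_finite)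
    have "c * min (\<Delta> / 4) (dper_set dq1 dq2 t T) \<le> c * dper_set dq1 dq2 t T"
      using c by (intro mult_left_mono) auto
    also have "\<dots> = (\<Delta> / (2 * K)) ^ (s - 1) * (dper_set dq1 dq2 t T / K) / N"
      unfolding c_def by simp
    also have "\<dots> \<le> (\<Prod>t'\<in>T. chord dq1 dq2 t t') / N"
      using prod_chord_ge[OF q fT sep _ K_def, of t] \<Delta> N T by (intro divide_right_mono) simp_all
    also have "\<dots> \<le> music_residual dq1 dq2 A B T t"
      unfolding N_def using music_residual_ge[of A B T dq1 dq2 t] fin fT gr T by simp
    finally show "c * min (\<Delta> / 4) (dper_set dq1 dq2 t T) \<le> music_residual dq1 dq2 A B T t" .
  qed
qed

end
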